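(* Let $G=(V,E)$ be a composite graph formed from disjoint connected undirected graphs $G_i=(V_i,E_i)$, $|V_i|=n_i$, $i=1,\dots,n$, with bridge nodes $l_i\in V_i$ and connected backbone graph $B=(V_B,E_B)$, $V_B=\{l_1,\dots,l_n\}$, and let $N=|V|$. Then: 1. The coherence of $G$ is $$H_C(G)=\frac{1}{2N}\Big(\sum_{i=1}^n 2n_iH_C(G_i)+\sum_{i=1}^n\sum_{j=i+1}^n|V_i||V_j|\,r(l_i,l_j)+\sum_{i=1}^n|V\setminus V_i|\,C_i(l_i)\Big).$$ 2. For fixed subgraphs $G_1,\dots,G_n$ and a fixed backbone topology (i.e. a fixed set of index pairs $\{i,j\}$ for which $(l_i,l_j)\in E_B$), the coherence $H_C(G)$, as a function of the choice of bridge nodes $l_i\in V_i$, is minimized by choosing $l_i\in\arg\min_{v\in V_i}C_i(v)$ for each $i=1,\dots,n$.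
   Context: Composite graph: given disjoint connected undirected graphs $G_i=(V_i,E_i)$, $i=1,\dots,n$, one node $l_i\in V_i$ (the bridge node of $G_i$) is chosen in each. The backbone graph $B=(V_B,E_B)$ is a connected undirected graph on $V_B=\{l_1,\dots,l_n\}$. The composite graph is $G=(V,E)$ with $V=V_1\cup\dots\cup V_n$ and $E=E_1\cup\dots\cup E_n\cup E_B$; so distinct subgraphs are connected only through edges between bridge nodes. Coherence: for a connected graph $G$ with $N$ nodes and (unweighted) Laplacian $L$, consider the noisy consensus dynamics $\dot x=-Lx+\nu$, with $\nu$ a zero-mean, unit-variance white noise. The network coherence is $H_C(G)=\lim_{t\to\infty}\sum_{j=1}^N\mathrm{var}\big(x_j-\frac1N\sum_{k=1}^Nx_k\big)$, which equals $\frac12\mathrm{tr}(L^\dagger)$, where $L^\dagger$ is the Moore–Penrose pseudo-inverse of $L$ (this known equality may be taken as the definition). $H_C(G_i)$ is the same quantity for the graph $G_i$ by itself. Resistance: $r(u,v)$ is the resistance distance between nodes $u$ and $v$ in $G$, i.e. the potential difference between $u$ and $v$ when every edge is a unit resistor and a unit current source is connected between $u$ and $v$. For $v\in V_i$, the resistance centrality within $G_i$ is $C_i(v)=\sum_{u\in V_i,\,u\ne v}r(u,v)$, with resistance distances computed in $G_i$ only. *)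

theory Defs
  imports
    Complex_Main
    "HOL-Library.Disjoint_Sets"
    "Graph_Theory.Graph_Theory"
begin

text \<open>
  A finite simple undirected graph is a \<^term>\<open>G :: 'a pair_pre_digraph\<close> satisfying
  \<^const>\<open>pair_graph\<close> (an undirected edge is a pair of opposite arcs).  A real matrix indexed by a
  finite set \<open>S\<close> is a function \<open>'a \<Rightarrow> 'a \<Rightarrow> real\<close>, of which only the entries in
  \<open>S \<times> S\<close> matter.
\<close>

definition matmul_on :: "'a set \<Rightarrow> ('a \<Rightarrow> 'a \<Rightarrow> real) \<Rightarrow> ('a \<Rightarrow> 'a \<Rightarrow> real) \<Rightarrow> 'a \<Rightarrow> 'a \<Rightarrow> real" where
  "matmul_on S A B = (\<lambda>i j. \<Sum>k\<in>S. A i k * B k j)"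

definition trace_on :: "'a set \<Rightarrow> ('a \<Rightarrow> 'a \<Rightarrow> real) \<Rightarrow> real" where
  "trace_on S A = (\<Sum>i\<in>S. A i i)"

text \<open>
  The four Penrose equations over the index set \<open>S\<close>.  The last conjunct only fixes the irrelevant
  entries, so that the pseudo-inverse is unique as a function.
\<close>

definition is_pseudo_inverse_on ::
  "'a set \<Rightarrow> ('a \<Rightarrow> 'a \<Rightarrow> real) \<Rightarrow> ('a \<Rightarrow> 'a \<Rightarrow> real) \<Rightarrow> bool" where
  "is_pseudo_inverse_on S A X \<longleftrightarrow>
     (\<forall>i\<in>S. \<forall>j\<in>S. matmul_on S (matmul_on S A X) A i j = A i j) \<and>
     (\<forall>i\<in>S. \<forall>j\<in>S. matmul_on S (matmul_on S X A) X i j = X i j) \<and>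
     (\<forall>i\<in>S. \<forall>j\<in>S. matmul_on S A X i j = matmul_on S A X j i) \<and>
     (\<forall>i\<in>S. \<forall>j\<in>S. matmul_on S X A i j = matmul_on S X A j i) \<and>
     (\<forall>i j. i \<notin> S \<or> j \<notin> S \<longrightarrow> X i j = 0)"

definition pseudo_inverse_on :: "'a set \<Rightarrow> ('a \<Rightarrow> 'a \<Rightarrow> real) \<Rightarrow> 'a \<Rightarrow> 'a \<Rightarrow> real" where
  "pseudo_inverse_on S A = (THE X. is_pseudo_inverse_on S A X)"

definition laplacian :: "'a pair_pre_digraph \<Rightarrow> 'a \<Rightarrow> 'a \<Rightarrow> real" where
  "laplacian G u v =
     (if u = v then real (out_degree (with_proj G) u)
      else if (u, v) \<in> parcs G then - 1
      else 0)"

text \<open>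
  The steady-state total variance of the deviation from the average in the dynamics
  \<open>x' = - L x + \<nu>\<close>, in its closed form: half the trace of the pseudo-inverse of \<open>L\<close>.
\<close>

definition coherence :: "'a pair_pre_digraph \<Rightarrow> real" where
  "coherence G = 1 / 2 * trace_on (pverts G) (pseudo_inverse_on (pverts G) (laplacian G))"

text \<open>
  Node potentials \<open>p\<close> when every edge is a unit resistor and a unit current enters at \<open>u\<close> and leaves
  at \<open>v\<close>.  By Ohm's law the edge from \<open>w\<close> to \<open>x\<close> carries the current \<open>p w - p x\<close>; the equation is
  Kirchhoff's current law at \<open>w\<close>.  In a connected graph \<open>p\<close> is unique up to an additive constant.
\<close>

definition unit_current_potential :: "'a pair_pre_digraph \<Rightarrow> 'a \<Rightarrow> 'a \<Rightarrow> ('a \<Rightarrow> real) \<Rightarrow> bool" where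
  "unit_current_potential G u v p \<longleftrightarrow>
     (\<forall>w\<in>pverts G. (\<Sum>x | (w, x) \<in> parcs G. p w - p x) =
        (if w = u then 1 else 0) - (if w = v then 1 else 0))"

definition resistance :: "'a pair_pre_digraph \<Rightarrow> 'a \<Rightarrow> 'a \<Rightarrow> real" where
  "resistance G u v = (THE r. \<exists>p. unit_current_potential G u v p \<and> r = p u - p v)"

definition resistance_centrality :: "'a pair_pre_digraph \<Rightarrow> 'a \<Rightarrow> real" where
  "resistance_centrality G v = (\<Sum>u\<in>pverts G - {v}. resistance G u v)"

definition composite_graph ::
  "nat \<Rightarrow> (nat \<Rightarrow> 'a pair_pre_digraph) \<Rightarrow> 'a pair_pre_digraph \<Rightarrow> 'a pair_pre_digraph" where
  "composite_graph n G B =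
     \<lparr>pverts = (\<Union>i\<in>{1..n}. pverts (G i)), parcs = (\<Union>i\<in>{1..n}. parcs (G i)) \<union> parcs B\<rparr>"

definition backbone_topology ::
  "nat \<Rightarrow> (nat \<Rightarrow> 'a) \<Rightarrow> 'a pair_pre_digraph \<Rightarrow> (nat \<times> nat) set" where
  "backbone_topology n l B = {(i, j). i \<in> {1..n} \<and> j \<in> {1..n} \<and> (l i, l j) \<in> parcs B}"

definition backbone_of :: "nat \<Rightarrow> (nat \<times> nat) set \<Rightarrow> (nat \<Rightarrow> 'a) \<Rightarrow> 'a pair_pre_digraph" where
  "backbone_of n T l = \<lparr>pverts = l ` {1..n}, parcs = (\<lambda>(i, j). (l i, l j)) ` T\<rparr>"

end

theory Submission
  imports Defs "Jordan_Normal_Form.Determinant"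
begin

text \<open>
  Coherence is total resistance in disguise.  Let \<open>X\<close> be the pseudo-inverse of the
  Laplacian of a connected graph on \<open>N\<close> vertices.  Its columns are potentials that sum to zero, so
  \<open>r(u,v) = X u u + X v v - X u v - X v u\<close>, and summing over all ordered pairs kills the mixed terms:
  the total resistance is \<open>2 N tr X = 4 N H\<^sub>C\<close> (lemma \<open>sum_resistance_eq_coherence\<close>).

  In a composite graph, resistances decompose because all current between \<open>V\<^sub>i\<close> and
  the rest passes the bridge \<open>l\<^sub>i\<close>.  A unit-current potential of one subgraph stays one when it is continued
  by its value at the bridge, and a potential of the backbone stays one when it is continued as a
  constant on every subgraph, since the current balance at a vertex of the composite graph is the sum of
  the balances in its subgraph and in the backbone (lemma \<open>net_current_composite\<close>).  Hence resistances
  inside one subgraph are unchanged, and for \<open>u\<close> in \<open>V\<^sub>i\<close> and \<open>v\<close> in \<open>V\<^sub>j\<close>, \<open>i \<noteq> j\<close>, adding three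
  potentials gives \<open>r(u,v) = r\<^sub>i(u,l\<^sub>i) + r(l\<^sub>i,l\<^sub>j) + r\<^sub>j(l\<^sub>j,v)\<close>.  Summing over all pairs of vertices
  yields the formula (lemma \<open>coherence_composite\<close>).

  The resistance between two bridges is their resistance in the backbone alone, so it depends only on
  the backbone topology.  With the subgraphs and the topology fixed, the last sum of the formula is thus
  the only part that the bridges influence, and each of its terms is a nonnegative multiple of
  \<open>C\<^sub>i(l\<^sub>i)\<close>; it is smallest when every \<open>C\<^sub>i(l\<^sub>i)\<close> is (lemma \<open>coherence_mono_bridges\<close>).
\<close>

section \<open>Linear systems and pseudo-inverses over a finite index set\<close>

text \<open>
  The Fredholm alternative for a square matrix whose index set is an arbitrary finite set: an
  enumeration of the index set carries it over from matrices indexed by an initial segment of the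
  natural numbers, where it is the statement about determinants.
\<close>

lemma square_system_solvable:
  fixes M :: "'a \<Rightarrow> 'a \<Rightarrow> 'b::field"
  assumes fin: "finite S"
    and inj: "\<And>x. \<forall>i\<in>S. (\<Sum>j\<in>S. M i j * x j) = 0 \<Longrightarrow> \<forall>j\<in>S. x j = 0"
  shows "\<exists>x. \<forall>i\<in>S. (\<Sum>j\<in>S. M i j * x j) = b i"
proof -
  define N where "N = card S"
  obtain e where e: "bij_betw e {0..<N} S"
    using ex_bij_betw_nat_finite[OF fin] N_def by blast
  define d where "d = inv_into {0..<N} e"
  have d: "d j < N" "e (d j) = j" if "j \<in> S" for j
    using that e inv_into_into[of j e "{0..<N}"] f_inv_into_f[of j e "{0..<N}"]
    by (auto simp: d_def bij_betw_def)
  have de: "d (e r) = r" if "r < N" for r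
    using that e by (simp add: d_def bij_betw_def)
  have eS: "e r \<in> S" if "r < N" for r
    using that e by (auto simp: bij_betw_def)
  have sum_S: "(\<Sum>j\<in>S. g j) = (\<Sum>c = 0..<N. g (e c))" for g :: "'a \<Rightarrow> 'b"
    using sum.reindex_bij_betw[OF e, of g] by simp
  define A where "A = mat N N (\<lambda>(r, c). M (e r) (e c))"
  have A: "A \<in> carrier_mat N N"
    by (simp add: A_def)
  have app: "(A *\<^sub>v v) $ r = (\<Sum>j\<in>S. M (e r) j * v $ d j)" if "v \<in> carrier_vec N" "r < N" for v r
    using that by (simp add: A_def scalar_prod_def sum_S de)
  have "det A \<noteq> 0"
  proof
    assume "det A = 0"
    then obtain v where v: "v \<in> carrier_vec N" "v \<noteq> 0\<^sub>v N" "A *\<^sub>v v = 0\<^sub>v N"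
      using det_0_iff_vec_prod_zero_field[OF A] by blast
    have "\<forall>i\<in>S. (\<Sum>j\<in>S. M i j * v $ d j) = 0"
      using app[OF v(1)] v(3) d by (metis index_zero_vec(1))
    then have "\<forall>j\<in>S. v $ d j = 0"
      by (rule inj)
    then have "v = 0\<^sub>v N"
      using v(1) de eS by (intro eq_vecI) (auto, metis)
    with v(2) show False ..
  qed
  from det_non_zero_imp_unit[OF A this, of "()"]
  obtain C where C: "C \<in> carrier_mat N N" and AC: "A * C = 1\<^sub>m N"
    by (auto simp: Units_def ring_mat_simps)
  define w where "w = C *\<^sub>v vec N (\<lambda>r. b (e r))"
  have w: "w \<in> carrier_vec N"
    using C by (simp add: w_def)
  have "A *\<^sub>v w = vec N (\<lambda>r. b (e r))"
    unfolding w_def using A C AC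
    by (metis assoc_mult_mat_vec one_mult_mat_vec vec_carrier)
  then have "\<forall>i\<in>S. (\<Sum>j\<in>S. M i j * w $ d j) = b i"
    using app[OF w] d by (metis index_vec)
  then show ?thesis
    by (rule exI[of _ "\<lambda>j. w $ d j"])
qed

lemma matmul_on_assoc:
  "matmul_on S (matmul_on S A B) C = matmul_on S A (matmul_on S B C)"
proof (intro ext)
  fix i j
  have "matmul_on S (matmul_on S A B) C i j = (\<Sum>k\<in>S. \<Sum>h\<in>S. A i h * (B h k * C k j))"
    by (simp add: matmul_on_def sum_distrib_right mult.assoc)
  also have "\<dots> = (\<Sum>h\<in>S. \<Sum>k\<in>S. A i h * (B h k * C k j))"
    by (rule sum.swap)
  also have "\<dots> = matmul_on S A (matmul_on S B C) i j"
    by (simp add: matmul_on_def sum_distrib_left)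
  finally show "matmul_on S (matmul_on S A B) C i j = matmul_on S A (matmul_on S B C) i j" .
qed

lemma matmul_on_cong:
  assumes "\<And>k. k \<in> S \<Longrightarrow> A i k = A' i k" "\<And>k. k \<in> S \<Longrightarrow> B k j = B' k j"
  shows "matmul_on S A B i j = matmul_on S A' B' i j"
  unfolding matmul_on_def by (rule sum.cong) (simp_all add: assms)

lemma symmetric_matmul_on_swap:
  assumes "\<And>i j. i \<in> S \<Longrightarrow> j \<in> S \<Longrightarrow> P i j = P j i" "\<And>i j. i \<in> S \<Longrightarrow> j \<in> S \<Longrightarrow> Q i j = Q j i"
    and "i \<in> S" "j \<in> S"
  shows "matmul_on S P Q i j = matmul_on S Q P j i"
  unfolding matmul_on_def
  by (rule sum.cong) (use assms in \<open>simp_all add: mult.commute\<close>)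

text \<open>
  Penrose's argument: \<open>A X\<close> and \<open>A Y\<close> are symmetric and \<open>A X = (A Y)(A X)\<close>, so transposing gives
  \<open>A X = (A X)(A Y) = A Y\<close>; likewise \<open>X A = Y A\<close>, and then \<open>X = X A X = X A Y = Y A Y = Y\<close>.
\<close>

lemma is_pseudo_inverse_on_unique:
  assumes "is_pseudo_inverse_on S A X" and "is_pseudo_inverse_on S A Y"
  shows "X = Y"
proof -
  let ?m = "matmul_on S"
  define pinv where "pinv Z \<longleftrightarrow>
     (\<forall>i\<in>S. \<forall>j\<in>S. ?m (?m A Z) A i j = A i j \<and> ?m (?m Z A) Z i j = Z i j \<and>
        ?m A Z i j = ?m A Z j i \<and> ?m Z A i j = ?m Z A j i)" for Z
  have pinv: "pinv X" "pinv Y"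
    using assms unfolding is_pseudo_inverse_on_def pinv_def by blast+
  have AZA: "?m (?m A Z) A i j = A i j" and ZAZ: "?m (?m Z A) Z i j = Z i j"
    and AZ_sym: "?m A Z i j = ?m A Z j i" and ZA_sym: "?m Z A i j = ?m Z A j i"
    if "pinv Z" "i \<in> S" "j \<in> S" for Z i j
    using that unfolding pinv_def by blast+
  have AX_AY: "?m A X i j = ?m A Y i j" if ij: "i \<in> S" "j \<in> S" for i j
  proof -
    have "?m A X i j = ?m (?m (?m A Y) A) X i j"
      by (rule matmul_on_cong) (simp_all add: AZA pinv ij)
    also have "\<dots> = ?m (?m A Y) (?m A X) i j"
      by (simp only: matmul_on_assoc)
    also have "\<dots> = ?m (?m A X) (?m A Y) j i"
      by (rule symmetric_matmul_on_swap) (rule AZ_sym pinv ij | assumption)+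
    also have "\<dots> = ?m (?m (?m A X) A) Y j i"
      by (simp only: matmul_on_assoc)
    also have "\<dots> = ?m A Y j i"
      by (rule matmul_on_cong) (simp_all add: AZA pinv ij)
    also have "\<dots> = ?m A Y i j"
      by (rule AZ_sym) (rule pinv ij)+
    finally show ?thesis .
  qed
  have XA_YA: "?m X A i j = ?m Y A i j" if ij: "i \<in> S" "j \<in> S" for i j
  proof -
    have "?m X A i j = ?m X (?m (?m A Y) A) i j"
      by (rule matmul_on_cong) (simp_all add: AZA pinv ij)
    also have "\<dots> = ?m (?m X A) (?m Y A) i j"
      by (simp only: matmul_on_assoc)
    also have "\<dots> = ?m (?m Y A) (?m X A) j i"
      by (rule symmetric_matmul_on_swap) (rule ZA_sym pinv ij | assumption)+
    also have "\<dots> = ?m Y (?m (?m A X) A) j i"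
      by (simp only: matmul_on_assoc)
    also have "\<dots> = ?m Y A j i"
      by (rule matmul_on_cong) (simp_all add: AZA pinv ij)
    also have "\<dots> = ?m Y A i j"
      by (rule ZA_sym) (rule pinv ij)+
    finally show ?thesis .
  qed
  have "X i j = Y i j" if ij: "i \<in> S" "j \<in> S" for i j
  proof -
    have "X i j = ?m (?m X A) X i j"
      by (rule ZAZ[symmetric]) (rule pinv ij)+
    also have "\<dots> = ?m X (?m A X) i j"
      by (simp only: matmul_on_assoc)
    also have "\<dots> = ?m X (?m A Y) i j"
      by (rule matmul_on_cong) (simp_all add: AX_AY ij)
    also have "\<dots> = ?m (?m X A) Y i j"
      by (simp only: matmul_on_assoc)
    also have "\<dots> = ?m (?m Y A) Y i j"
      by (rule matmul_on_cong) (simp_all add: XA_YA ij)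
    also have "\<dots> = Y i j"
      by (rule ZAZ) (rule pinv ij)+
    finally show ?thesis .
  qed
  moreover have "X i j = Y i j" if "i \<notin> S \<or> j \<notin> S" for i j
    using assms that unfolding is_pseudo_inverse_on_def by metis
  ultimately show ?thesis
    by (intro ext) blast
qed

section \<open>Currents and potentials\<close>

text \<open>
  The current that the potential \<open>p\<close> drives out of \<open>w\<close>, which is the graph Laplacian applied to \<open>p\<close>.
  The sum ranges over arcs, not over vertex pairs as in the matrix form: in this shape it is additive
  over edge-disjoint unions of graphs.
\<close>

definition net_current :: "'a pair_pre_digraph \<Rightarrow> ('a \<Rightarrow> real) \<Rightarrow> 'a \<Rightarrow> real" where
  "net_current G p w = (\<Sum>x | (w, x) \<in> parcs G. p w - p x)"

lemma unit_current_potential_iff: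
  "unit_current_potential G u v p \<longleftrightarrow>
     (\<forall>w\<in>pverts G. net_current G p w = of_bool (w = u) - of_bool (w = v))"
  by (auto simp: unit_current_potential_def net_current_def of_bool_def)

lemma net_current_add: "net_current G (\<lambda>x. p x + q x) w = net_current G p w + net_current G q w"
  by (simp add: net_current_def sum.distrib[symmetric] algebra_simps)

lemma net_current_diff: "net_current G (\<lambda>x. p x - q x) w = net_current G p w - net_current G q w"
  by (simp add: net_current_def sum_subtractf[symmetric] algebra_simps)

lemma net_current_const [simp]: "net_current G (\<lambda>x. c) w = 0"
  by (simp add: net_current_def)

lemma unit_current_potential_series:
  assumes "unit_current_potential G u v p" "unit_current_potential G v w q"
  shows "unit_current_potential G u w (\<lambda>x. p x + q x)"
  using assms by (simp add: unit_current_potential_iff net_current_add)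

lemma (in pair_wf_digraph) net_current_cong:
  assumes "\<And>x. x \<in> pverts G \<Longrightarrow> p x = q x" "w \<in> pverts G"
  shows "net_current G p w = net_current G q w"
  unfolding net_current_def using assms by (intro sum.cong) (auto dest: in_arcsD2)

lemma (in pair_graph) connected_iff_rtrancl:
  "Digraph_Component.connected (with_proj G) \<longleftrightarrow>
     pverts G \<noteq> {} \<and> (\<forall>u\<in>pverts G. \<forall>v\<in>pverts G. (u, v) \<in> (parcs G)\<^sup>*)"
proof -
  have "symcl (parcs G) = parcs G"
    by (auto simp: symcl_def intro: arcs_symmetric)
  moreover have "(u, v) \<in> rtrancl_on (pverts G) (parcs G) \<longleftrightarrow> (u, v) \<in> (parcs G)\<^sup>*"
    if "u \<in> pverts G" "v \<in> pverts G" for u v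
    using that rtrancl_consistent_rtrancl_on[of u v "parcs G" "pverts G"]
    by (auto intro: rtrancl_on_rtranclI dest: in_arcsD2)
  ultimately show ?thesis
    unfolding connected_conv by simp
qed

context pair_graph
begin

lemma laplacian_sym: "laplacian G u v = laplacian G v u"
  by (auto simp: laplacian_def intro: arcs_symmetric)

lemma laplacian_apply:
  assumes w: "w \<in> pverts G"
  shows "(\<Sum>k\<in>pverts G. laplacian G w k * p k) = net_current G p w"
proof -
  let ?nbrs = "{x. (w, x) \<in> parcs G}"
  have nbrs: "?nbrs \<subseteq> pverts G - {w}"
    using no_loops' by (auto dest: in_arcsD2)
  have fin: "finite ?nbrs"
    by (rule finite_subset[OF nbrs]) (simp add: pair_finite_verts)
  have "out_arcs (with_proj G) w = Pair w ` ?nbrs"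
    by (auto simp: out_arcs_def)
  then have deg: "out_degree (with_proj G) w = card ?nbrs"
    by (simp add: out_degree_def card_image inj_on_def)
  have "(\<Sum>k\<in>pverts G - {w}. laplacian G w k * p k)
      = (\<Sum>k\<in>pverts G - {w}. if k \<in> ?nbrs then - p k else 0)"
    by (intro sum.cong) (auto simp: laplacian_def)
  also have "\<dots> = - (\<Sum>k\<in>?nbrs. p k)"
    using nbrs pair_finite_verts
    by (subst sum.inter_restrict[symmetric]) (simp_all add: sum_negf Int_absorb1)
  finally show ?thesis
    unfolding sum.remove[OF pair_finite_verts w]
    by (simp add: laplacian_def deg net_current_def sum_subtractf)
qed

lemma net_current_self_adjoint:
  "(\<Sum>w\<in>pverts G. q w * net_current G p w) = (\<Sum>w\<in>pverts G. p w * net_current G q w)"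
proof -
  have "(\<Sum>w\<in>pverts G. q w * net_current G p w)
      = (\<Sum>w\<in>pverts G. \<Sum>k\<in>pverts G. q w * (laplacian G w k * p k))"
    by (simp add: laplacian_apply[symmetric] sum_distrib_left)
  also have "\<dots> = (\<Sum>k\<in>pverts G. \<Sum>w\<in>pverts G. p k * (laplacian G k w * q w))"
    by (subst sum.swap) (intro sum.cong refl, simp add: laplacian_sym mult_ac)
  also have "\<dots> = (\<Sum>w\<in>pverts G. p w * net_current G q w)"
    by (simp add: laplacian_apply[symmetric] sum_distrib_left)
  finally show ?thesis .
qed

lemma sum_net_current: "(\<Sum>w\<in>pverts G. net_current G p w) = 0"
  using net_current_self_adjoint[of "\<lambda>_. 1" p] by simp

end

section \<open>Resistance and coherence of a connected graph\<close>

locale connected_pair_graph = pair_graph +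
  assumes connected: "Digraph_Component.connected (with_proj G)"
begin

lemma nonempty: "pverts G \<noteq> {}"
  using connected connected_iff_rtrancl by blast

lemma card_pverts_pos: "card (pverts G) > 0"
  using nonempty pair_finite_verts by (simp add: card_gt_0_iff)

text \<open>
  The maximum principle: where a potential without current sources attains its maximum, all neighbours
  attain it too, and the maximum spreads along paths to the whole graph.
\<close>

lemma net_current_zero_imp_const:
  assumes zero: "\<And>w. w \<in> pverts G \<Longrightarrow> net_current G p w = 0"
    and u: "u \<in> pverts G" and v: "v \<in> pverts G"
  shows "p u = p v"
proof -
  obtain m where m: "m \<in> pverts G" and max: "\<And>x. x \<in> pverts G \<Longrightarrow> p x \<le> p m"
    using finite_imageI[OF pair_finite_verts, of p] nonempty Max_in[of "p ` pverts G"] Max_ge[of "p ` pverts G"]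
    by (metis (no_types, lifting) image_iff image_is_empty)
  have "p x = p m" if x: "x \<in> pverts G" for x
  proof -
    have "(m, x) \<in> (parcs G)\<^sup>*"
      using connected connected_iff_rtrancl m x by blast
    then show ?thesis
    proof (induction rule: rtrancl_induct)
      case (step y z)
      have y: "y \<in> pverts G"
        using step.hyps(2) by (rule in_arcsD1)
      have fin: "finite {x. (y, x) \<in> parcs G}"
        by (rule finite_subset[OF _ pair_finite_verts]) (auto dest: in_arcsD2)
      have "p y - p x \<ge> 0" if "(y, x) \<in> parcs G" for x
        using max in_arcsD2[OF that] step.IH by simp
      then have "p y - p z = 0"
        using zero[OF y] fin step.hyps(2) sum_nonneg_eq_0_iff[of "{x. (y, x) \<in> parcs G}" "\<lambda>x. p y - p x"]
        by (simp add: net_current_def)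
      with step.IH show ?case by simp
    qed simp
  qed
  with u v show ?thesis by simp
qed

text \<open>
  The Laplacian \<open>L\<close> is singular, but \<open>L + J\<close> with \<open>J\<close> the all-ones matrix is not: the entries of
  \<open>L x\<close> always sum to zero, so summing the equations of \<open>(L + J) x = c\<close> for balanced \<open>c\<close> gives
  \<open>J x = 0\<close>.  Consequently \<open>L x = c\<close>, and for \<open>c = 0\<close> such an \<open>x\<close> is constant of sum zero.
\<close>

lemma net_current_solvable:
  assumes b: "(\<Sum>w\<in>pverts G. b w) = 0"
  obtains p where "\<And>w. w \<in> pverts G \<Longrightarrow> net_current G p w = b w" "(\<Sum>w\<in>pverts G. p w) = 0"
proof -
  let ?V = "pverts G"
  let ?M = "\<lambda>i j. laplacian G i j + 1"
  have M: "(\<Sum>j\<in>?V. ?M i j * x j) = net_current G x i + (\<Sum>j\<in>?V. x j)" if "i \<in> ?V" for i x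
    using that by (simp add: distrib_right sum.distrib laplacian_apply)
  have mean: "(\<Sum>j\<in>?V. x j) = 0"
    if "\<forall>i\<in>?V. net_current G x i + (\<Sum>j\<in>?V. x j) = c i" "(\<Sum>i\<in>?V. c i) = 0" for x c
  proof -
    have "0 = (\<Sum>i\<in>?V. net_current G x i + (\<Sum>j\<in>?V. x j))"
      using that by simp
    also have "\<dots> = real (card ?V) * (\<Sum>j\<in>?V. x j)"
      by (simp add: sum.distrib sum_net_current)
    finally show ?thesis
      using card_pverts_pos nonempty by simp
  qed
  have inj: "\<forall>j\<in>?V. x j = 0" if x: "\<forall>i\<in>?V. (\<Sum>j\<in>?V. ?M i j * x j) = 0" for x
  proof
    fix j assume j: "j \<in> ?V"
    have s: "(\<Sum>j\<in>?V. x j) = 0"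
      using mean[of x "\<lambda>_. 0"] x M by simp
    then have "x k = x j" if "k \<in> ?V" for k
      using net_current_zero_imp_const[of x k j] x M j that by simp
    then have "real (card ?V) * x j = 0"
      using s by simp
    then show "x j = 0"
      using card_pverts_pos nonempty by simp
  qed
  obtain p where "\<forall>i\<in>?V. (\<Sum>j\<in>?V. ?M i j * p j) = b i"
    using square_system_solvable[OF pair_finite_verts, of ?M b] inj by blast
  then have "\<forall>i\<in>?V. net_current G p i + (\<Sum>j\<in>?V. p j) = b i"
    by (simp add: M)
  then show ?thesis
    using mean[of p b] b by (intro that[of p]) auto
qed

lemma ex_unit_current_potential:
  assumes "u \<in> pverts G" "v \<in> pverts G"
  shows "\<exists>p. unit_current_potential G u v p"
proof -
  have "(\<Sum>w\<in>pverts G. of_bool (w = u) - of_bool (w = v) :: real) = 0"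
    using assms pair_finite_verts by (simp add: sum_subtractf of_bool_def)
  then obtain p where "\<And>w. w \<in> pverts G \<Longrightarrow> net_current G p w = of_bool (w = u) - of_bool (w = v)"
    using net_current_solvable[of "\<lambda>w. of_bool (w = u) - of_bool (w = v)"] by blast
  then show ?thesis
    unfolding unit_current_potential_iff by blast
qed

lemma resistance_eq:
  assumes p: "unit_current_potential G u v p" and uv: "u \<in> pverts G" "v \<in> pverts G"
  shows "resistance G u v = p u - p v"
  unfolding resistance_def
proof (rule the_equality)
  fix r assume "\<exists>q. unit_current_potential G u v q \<and> r = q u - q v"
  then obtain q where q: "unit_current_potential G u v q" "r = q u - q v" by blast
  have "q u - p u = q v - p v"
    using p q(1) uv
    by (intro net_current_zero_imp_const[of "\<lambda>x. q x - p x"])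
      (simp_all add: unit_current_potential_iff net_current_diff)
  with q(2) show "r = p u - p v" by simp
qed (use p in blast)

lemma resistance_self: "u \<in> pverts G \<Longrightarrow> resistance G u u = 0"
  using resistance_eq[of u u "\<lambda>_. 0"] by (simp add: unit_current_potential_iff)

lemma resistance_commute:
  assumes "u \<in> pverts G" "v \<in> pverts G"
  shows "resistance G u v = resistance G v u"
proof -
  obtain p where p: "unit_current_potential G u v p"
    using ex_unit_current_potential assms by blast
  then have "unit_current_potential G v u (\<lambda>x. 0 - p x)"
    unfolding unit_current_potential_iff net_current_diff by simp
  then show ?thesis
    using resistance_eq[OF p] resistance_eq[of v u "\<lambda>x. 0 - p x"] assms by simp
qed

lemma resistance_centrality_eq_sum:
  assumes "v \<in> pverts G"
  shows "resistance_centrality G v = (\<Sum>u\<in>pverts G. resistance G u v)"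
  unfolding resistance_centrality_def sum.remove[OF pair_finite_verts assms]
  by (simp add: resistance_self assms)

text \<open>
  The pseudo-inverse is written down explicitly: its column \<open>j\<close> is the potential \<open>p j\<close> of sum zero with
  \<open>L (p j) = e\<^sub>j - 1/N\<close>.  Differences of two columns are unit-current potentials, which expresses every
  resistance by entries of the pseudo-inverse; the rows sum to zero, so only the trace survives in
  the sum.
\<close>

lemma sum_resistance_eq_coherence:
  "(\<Sum>u\<in>pverts G. \<Sum>v\<in>pverts G. resistance G u v) = 4 * real (card (pverts G)) * coherence G"
proof -
  let ?V = "pverts G" and ?N = "real (card (pverts G))" and ?L = "laplacian G"
  have N: "?N > 0" and fin: "finite ?V"
    using card_pverts_pos pair_finite_verts by auto
  \<comment> \<open>The projection onto the vectors of sum zero; both products of \<open>L\<close> with its pseudo-inverse equal it.\<close>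
  define P where "P = (\<lambda>(i :: 'a) j. of_bool (i = j) - 1 / ?N :: real)"
  have P_sym: "P i j = P j i" for i j
    by (auto simp: P_def)
  have "\<exists>p. (\<forall>w\<in>?V. net_current G p w = P w j) \<and> (\<Sum>w\<in>?V. p w) = 0" if "j \<in> ?V" for j
  proof -
    have "(\<Sum>w\<in>?V. P w j) = 0"
      using that fin nonempty by (simp add: P_def sum_subtractf of_bool_def)
    then show ?thesis
      using net_current_solvable[of "\<lambda>w. P w j"] by metis
  qed
  then obtain p where p: "\<And>w j. w \<in> ?V \<Longrightarrow> j \<in> ?V \<Longrightarrow> net_current G (p j) w = P w j"
    and p0: "\<And>j. j \<in> ?V \<Longrightarrow> (\<Sum>w\<in>?V. p j w) = 0"
    by metis
  \<comment> \<open>Both entries are the same value of the self-adjoint pairing of \<open>p i\<close> with \<open>p j\<close>.\<close>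
  have p_sym: "p j i = p i j" if "i \<in> ?V" "j \<in> ?V" for i j
  proof -
    have pair: "(\<Sum>w\<in>?V. p b w * net_current G (p a) w) = p b a" if "a \<in> ?V" "b \<in> ?V" for a b
    proof -
      have "(\<Sum>w\<in>?V. p b w * net_current G (p a) w)
          = (\<Sum>w\<in>?V. (if w = a then p b w else 0) - p b w / ?N)"
        using that by (intro sum.cong) (auto simp: p P_def algebra_simps)
      also have "\<dots> = p b a"
        using that p0 fin by (simp add: sum_subtractf sum_divide_distrib[symmetric])
      finally show ?thesis .
    qed
    show ?thesis
      using net_current_self_adjoint[of "p j" "p i"] pair[of i j] pair[of j i] that by simp
  qed
  define X where "X = (\<lambda>i j. if i \<in> ?V \<and> j \<in> ?V then p j i else 0)"
  let ?m = "matmul_on ?V"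
  have LX: "?m ?L X i j = P i j" if "i \<in> ?V" "j \<in> ?V" for i j
    using that by (simp add: matmul_on_def X_def laplacian_apply p)
  have XL: "?m X ?L i j = P i j" if "i \<in> ?V" "j \<in> ?V" for i j
  proof -
    have "?m X ?L i j = ?m ?L X j i"
      using that by (simp add: matmul_on_def X_def p_sym laplacian_sym mult.commute)
    then show ?thesis
      using that LX by (simp add: P_sym)
  qed
  have P_absorb: "?m P A i j = A i j" if "i \<in> ?V" "(\<Sum>k\<in>?V. A k j) = 0" for A i j
    using that fin
    by (simp add: matmul_on_def P_def left_diff_distrib sum_subtractf sum_divide_distrib[symmetric]
        of_bool_def if_distrib[of "\<lambda>x. x * _"] cong: if_cong)
  have "is_pseudo_inverse_on ?V ?L X"
    unfolding is_pseudo_inverse_on_def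
  proof (intro conjI ballI allI impI)
    fix i j assume ij: "i \<in> ?V" "j \<in> ?V"
    have "(\<Sum>k\<in>?V. ?L k j) = 0"
      using laplacian_apply[OF ij(2), of "\<lambda>_. 1"] by (simp add: laplacian_sym)
    then show "?m (?m ?L X) ?L i j = ?L i j"
      using ij LX P_absorb matmul_on_cong[of ?V "?m ?L X" i P ?L j ?L] by simp
    have "(\<Sum>k\<in>?V. X k j) = 0"
      using ij p0 by (simp add: X_def)
    then show "?m (?m X ?L) X i j = X i j"
      using ij XL P_absorb matmul_on_cong[of ?V "?m X ?L" i P X j X] by simp
  next
    fix i j assume ij: "i \<in> ?V" "j \<in> ?V"
    show "?m ?L X i j = ?m ?L X j i" "?m X ?L i j = ?m X ?L j i"
      using ij by (simp_all add: LX XL P_sym)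
  qed (auto simp: X_def)
  then have X: "pseudo_inverse_on ?V ?L = X"
    unfolding pseudo_inverse_on_def
    by (intro the_equality) (auto intro: is_pseudo_inverse_on_unique)
  have r: "resistance G u v = p u u + p v v - p u v - p v u" if "u \<in> ?V" "v \<in> ?V" for u v
  proof -
    have "unit_current_potential G u v (\<lambda>x. p u x - p v x)"
      unfolding unit_current_potential_iff net_current_diff using that by (simp add: p P_def)
    from resistance_eq[OF this that] show ?thesis by simp
  qed
  have "(\<Sum>u\<in>?V. \<Sum>v\<in>?V. resistance G u v) = (\<Sum>u\<in>?V. \<Sum>v\<in>?V. p u u + p v v - p u v - p v u)"
    by (intro sum.cong refl r)
  also have "\<dots> = 2 * ?N * (\<Sum>u\<in>?V. p u u) - 2 * (\<Sum>u\<in>?V. \<Sum>v\<in>?V. p u v)"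
    using sum.swap[of "\<lambda>u v. p v u" ?V ?V]
    by (simp add: sum.distrib sum_subtractf sum_distrib_left[symmetric])
  also have "\<dots> = 2 * ?N * trace_on ?V X"
    using p0 by (simp add: trace_on_def X_def)
  finally show ?thesis
    by (simp add: coherence_def X)
qed

end

section \<open>Resistances in a composite graph\<close>

locale composite =
  fixes n :: nat and G :: "nat \<Rightarrow> 'a pair_pre_digraph" and l :: "nat \<Rightarrow> 'a"
    and B :: "'a pair_pre_digraph"
  assumes subgraph: "i \<in> {1..n} \<Longrightarrow> connected_pair_graph (G i)"
    and disjoint: "disjoint_family_on (\<lambda>i. pverts (G i)) {1..n}"
    and bridge: "i \<in> {1..n} \<Longrightarrow> l i \<in> pverts (G i)"
    and backbone: "connected_pair_graph B"
    and pverts_backbone: "pverts B = l ` {1..n}"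
begin

abbreviation "H \<equiv> composite_graph n G B"

sublocale B: connected_pair_graph B
  by (rule backbone)

lemma same_subgraph:
  assumes "i \<in> {1..n}" "j \<in> {1..n}" "x \<in> pverts (G i)" "x \<in> pverts (G j)"
  shows "i = j"
  using disjoint assms unfolding disjoint_family_on_def by blast

lemma bridge_in_backbone: "i \<in> {1..n} \<Longrightarrow> l i \<in> pverts B"
  using pverts_backbone by simp

lemma bridge_inj: "i \<in> {1..n} \<Longrightarrow> j \<in> {1..n} \<Longrightarrow> l i = l j \<longleftrightarrow> i = j"
  using same_subgraph bridge by metis

lemma in_pverts_compositeI: "i \<in> {1..n} \<Longrightarrow> x \<in> pverts (G i) \<Longrightarrow> x \<in> pverts H"
  by (auto simp: composite_graph_def)

lemma in_pverts_compositeE: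
  assumes "x \<in> pverts H"
  obtains i where "i \<in> {1..n}" "x \<in> pverts (G i)"
  using assms by (auto simp: composite_graph_def)

lemma out_neighbours:
  assumes i: "i \<in> {1..n}" and w: "w \<in> pverts (G i)"
  shows "{x. (w, x) \<in> parcs H} = {x. (w, x) \<in> parcs (G i)} \<union> {x. (w, x) \<in> parcs B}"
proof -
  have "j = i" if "j \<in> {1..n}" "(w, x) \<in> parcs (G j)" for j x
  proof -
    interpret Gj: connected_pair_graph "G j" by (rule subgraph) fact
    show ?thesis
      using same_subgraph[of j i w] Gj.in_arcsD1 that i w by blast
  qed
  then show ?thesis
    using i unfolding composite_graph_def by (simp only: pair_pre_digraph.select_convs) blast
qed

text \<open>
  The backbone and the subgraphs share no edge: an edge inside one subgraph that is also a backbone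
  edge would join the bridge of that subgraph to itself.
\<close>

lemma net_current_composite:
  assumes i: "i \<in> {1..n}" and w: "w \<in> pverts (G i)"
  shows "net_current H p w = net_current (G i) p w + net_current B p w"
proof -
  interpret Gi: connected_pair_graph "G i" by (rule subgraph) fact
  have False if arcs: "(w, x) \<in> parcs (G i)" "(w, x) \<in> parcs B" for x
  proof -
    obtain j k where jk: "j \<in> {1..n}" "w = l j" "k \<in> {1..n}" "x = l k"
      using B.in_arcsD1[OF arcs(2)] B.in_arcsD2[OF arcs(2)] unfolding pverts_backbone by blast
    then have "j = i" "k = i"
      using same_subgraph[of j i w] same_subgraph[of k i x] bridge i w Gi.in_arcsD2[OF arcs(1)] by blast+
    with jk B.no_loops' arcs(2) show False by blast
  qed
  then have "{x. (w, x) \<in> parcs (G i)} \<inter> {x. (w, x) \<in> parcs B} = {}"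
    by blast
  moreover have "finite {x. (w, x) \<in> parcs (G i)}" "finite {x. (w, x) \<in> parcs B}"
    by (rule finite_subset[OF _ Gi.pair_finite_verts], auto dest: Gi.in_arcsD2)
      (rule finite_subset[OF _ B.pair_finite_verts], auto dest: B.in_arcsD2)
  ultimately show ?thesis
    unfolding net_current_def out_neighbours[OF assms] by (intro sum.union_disjoint)
qed

lemma net_current_backbone_interior:
  assumes "i \<in> {1..n}" "w \<in> pverts (G i)" "w \<noteq> l i"
  shows "net_current B p w = 0"
proof -
  have "w \<notin> pverts B"
    unfolding pverts_backbone using same_subgraph bridge assms by blast
  then have "{x. (w, x) \<in> parcs B} = {}"
    using B.in_arcsD1 by blast
  then show ?thesis
    by (simp add: net_current_def)
qed

lemma pair_graph_composite: "pair_graph H"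
proof
  fix e assume "e \<in> parcs H"
  then consider i where "i \<in> {1..n}" "e \<in> parcs (G i)" | "e \<in> parcs B"
    by (auto simp: composite_graph_def)
  then have "fst e \<in> pverts H \<and> snd e \<in> pverts H \<and> fst e \<noteq> snd e"
  proof cases
    case 1
    interpret Gi: connected_pair_graph "G i" by (rule subgraph) fact
    show ?thesis
      using 1 Gi.arc_fst_in_verts Gi.arc_snd_in_verts Gi.pair_no_loops in_pverts_compositeI by blast
  next
    case 2
    have "pverts B \<subseteq> pverts H"
      unfolding pverts_backbone using bridge in_pverts_compositeI by blast
    then show ?thesis
      using 2 B.arc_fst_in_verts B.arc_snd_in_verts B.pair_no_loops by blast
  qed
  then show "fst e \<in> pverts H" "snd e \<in> pverts H" "fst e \<noteq> snd e"
    by blast+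
next
  show "finite (pverts H)" "finite (parcs H)"
    using subgraph B.pair_finite_arcs
    by (auto simp: composite_graph_def connected_pair_graph_def pair_graph_def pair_digraph_def
        intro: pair_fin_digraph.pair_finite_verts pair_fin_digraph.pair_finite_arcs)
next
  have "(y, x) \<in> parcs H" if "(x, y) \<in> parcs H" for x y
  proof -
    from that consider i where "i \<in> {1..n}" "(x, y) \<in> parcs (G i)" | "(x, y) \<in> parcs B"
      by (auto simp: composite_graph_def)
    then show ?thesis
    proof cases
      case 1
      interpret Gi: connected_pair_graph "G i" by (rule subgraph) fact
      show ?thesis
        using 1 Gi.arcs_symmetric unfolding composite_graph_def by fastforce
    qed (use B.arcs_symmetric in \<open>auto simp: composite_graph_def\<close>)
  qed
  then show "symmetric (with_proj H)"
    by (auto simp: symmetric_def sym_def)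
qed

sublocale H: connected_pair_graph H
proof -
  interpret pair_graph H by (rule pair_graph_composite)
  have sub: "(x, y) \<in> (parcs H)\<^sup>*" if i: "i \<in> {1..n}" and "x \<in> pverts (G i)" "y \<in> pverts (G i)" for i x y
  proof -
    interpret Gi: connected_pair_graph "G i" by (rule subgraph) fact
    have "(parcs (G i))\<^sup>* \<subseteq> (parcs H)\<^sup>*"
      using i by (intro rtrancl_mono) (auto simp: composite_graph_def)
    then show ?thesis
      using that Gi.connected Gi.connected_iff_rtrancl by blast
  qed
  have backbone_path: "(l i, l j) \<in> (parcs H)\<^sup>*" if "i \<in> {1..n}" "j \<in> {1..n}" for i j
  proof -
    have "(parcs B)\<^sup>* \<subseteq> (parcs H)\<^sup>*"
      by (intro rtrancl_mono) (auto simp: composite_graph_def)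
    then show ?thesis
      using that bridge_in_backbone B.connected B.connected_iff_rtrancl by blast
  qed
  have "(x, y) \<in> (parcs H)\<^sup>*" if "x \<in> pverts H" "y \<in> pverts H" for x y
  proof -
    obtain i j where ij: "i \<in> {1..n}" "x \<in> pverts (G i)" "j \<in> {1..n}" "y \<in> pverts (G j)"
      using \<open>x \<in> pverts H\<close> \<open>y \<in> pverts H\<close> by (metis in_pverts_compositeE)
    then have "(x, l i) \<in> (parcs H)\<^sup>*" "(l i, l j) \<in> (parcs H)\<^sup>*" "(l j, y) \<in> (parcs H)\<^sup>*"
      using sub backbone_path bridge by blast+
    then show ?thesis
      by (meson rtrancl_trans)
  qed
  moreover have "pverts H \<noteq> {}"
    using B.nonempty bridge in_pverts_compositeI unfolding pverts_backbone by blast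
  ultimately show "connected_pair_graph H"
    by unfold_locales (use connected_iff_rtrancl in blast)
qed

definition extend_block :: "nat \<Rightarrow> ('a \<Rightarrow> real) \<Rightarrow> 'a \<Rightarrow> real" where
  "extend_block i p x = (if x \<in> pverts (G i) then p x else p (l i))"

lemma extend_block_other:
  "i \<in> {1..n} \<Longrightarrow> j \<in> {1..n} \<Longrightarrow> i \<noteq> j \<Longrightarrow> x \<in> pverts (G j) \<Longrightarrow> extend_block i p x = p (l i)"
  using same_subgraph[of i j x] by (auto simp: extend_block_def)

text \<open>
  All bridges are at the same potential, so the backbone carries no current, and neither do
  the other subgraphs.
\<close>

lemma extend_block_potential:
  assumes i: "i \<in> {1..n}" and uv: "u \<in> pverts (G i)" "v \<in> pverts (G i)"
    and p: "unit_current_potential (G i) u v p"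
  shows "unit_current_potential H u v (extend_block i p)"
  unfolding unit_current_potential_iff
proof
  fix w assume "w \<in> pverts H"
  then obtain j where j: "j \<in> {1..n}" "w \<in> pverts (G j)"
    by (rule in_pverts_compositeE)
  interpret Gj: connected_pair_graph "G j" by (rule subgraph) fact
  have "extend_block i p x = p (l i)" if x: "x \<in> pverts B" for x
  proof -
    obtain k where k: "k \<in> {1..n}" "x = l k"
      using x unfolding pverts_backbone by blast
    then show ?thesis
      using extend_block_other[OF i, of k x] bridge by (cases "k = i") (auto simp: extend_block_def)
  qed
  then have "extend_block i p w = extend_block i p x" if "(w, x) \<in> parcs B" for x
    using B.in_arcsD1[OF that] B.in_arcsD2[OF that] by simp
  then have "net_current B (extend_block i p) w = 0"
    by (simp add: net_current_def)
  moreover have "net_current (G j) (extend_block i p) w = of_bool (w = u) - of_bool (w = v)"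
  proof (cases "j = i")
    case True
    have "net_current (G j) (extend_block i p) w = net_current (G j) p w"
      using True j by (intro Gj.net_current_cong) (auto simp: extend_block_def)
    then show ?thesis
      using p True j by (simp add: unit_current_potential_iff)
  next
    case False
    have "net_current (G j) (extend_block i p) w = net_current (G j) (\<lambda>_. p (l i)) w"
      using False i j by (intro Gj.net_current_cong) (auto simp: extend_block_other)
    moreover have "w \<noteq> u" "w \<noteq> v"
      using same_subgraph[of j i w] False i j uv by auto
    ultimately show ?thesis by simp
  qed
  ultimately show "net_current H (extend_block i p) w = of_bool (w = u) - of_bool (w = v)"
    using net_current_composite[OF j] by simp
qed

definition extend_backbone :: "('a \<Rightarrow> real) \<Rightarrow> 'a \<Rightarrow> real" where
  "extend_backbone q x = q (l (THE i. i \<in> {1..n} \<and> x \<in> pverts (G i)))"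

lemma extend_backbone_eq:
  assumes "i \<in> {1..n}" "x \<in> pverts (G i)"
  shows "extend_backbone q x = q (l i)"
proof -
  have "(THE i. i \<in> {1..n} \<and> x \<in> pverts (G i)) = i"
    by (intro the_equality) (use assms same_subgraph in blast)+
  then show ?thesis
    by (simp add: extend_backbone_def)
qed

text \<open>
  Every subgraph is equipotential, so current flows in the backbone only.
\<close>

lemma extend_backbone_potential:
  assumes ij: "i \<in> {1..n}" "j \<in> {1..n}"
    and q: "unit_current_potential B (l i) (l j) q"
  shows "unit_current_potential H (l i) (l j) (extend_backbone q)"
  unfolding unit_current_potential_iff
proof
  fix w assume "w \<in> pverts H"
  then obtain k where k: "k \<in> {1..n}" "w \<in> pverts (G k)"
    by (rule in_pverts_compositeE)
  interpret Gk: connected_pair_graph "G k" by (rule subgraph) fact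
  have "net_current (G k) (extend_backbone q) w = net_current (G k) (\<lambda>_. q (l k)) w"
    using k by (intro Gk.net_current_cong) (auto simp: extend_backbone_eq)
  moreover have "net_current B (extend_backbone q) w = of_bool (w = l i) - of_bool (w = l j)"
  proof (cases "w = l k")
    case True
    have "net_current B (extend_backbone q) w = net_current B q w"
      using True k bridge_in_backbone bridge
      by (intro B.net_current_cong) (auto simp: pverts_backbone extend_backbone_eq)
    then show ?thesis
      using q True k bridge_in_backbone by (simp add: unit_current_potential_iff)
  next
    case False
    then have "w \<noteq> l i" "w \<noteq> l j"
      using same_subgraph[of k i w] same_subgraph[of k j w] k ij bridge by auto
    then show ?thesis
      using net_current_backbone_interior[OF k False] by simp
  qed
  ultimately show "net_current H (extend_backbone q) w = of_bool (w = l i) - of_bool (w = l j)"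
    using net_current_composite[OF k] by simp
qed

lemma resistance_same_subgraph:
  assumes i: "i \<in> {1..n}" and uv: "u \<in> pverts (G i)" "v \<in> pverts (G i)"
  shows "resistance H u v = resistance (G i) u v"
proof -
  interpret Gi: connected_pair_graph "G i" by (rule subgraph) fact
  obtain p where p: "unit_current_potential (G i) u v p"
    using Gi.ex_unit_current_potential uv by blast
  from H.resistance_eq[OF extend_block_potential[OF assms p]] Gi.resistance_eq[OF p uv]
  show ?thesis
    using assms in_pverts_compositeI by (auto simp: extend_block_def)
qed

lemma resistance_bridges:
  assumes ij: "i \<in> {1..n}" "j \<in> {1..n}"
  shows "resistance H (l i) (l j) = resistance B (l i) (l j)"
proof -
  note lB = bridge_in_backbone[OF ij(1)] bridge_in_backbone[OF ij(2)]
  obtain q where q: "unit_current_potential B (l i) (l j) q"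
    using B.ex_unit_current_potential lB by blast
  from H.resistance_eq[OF extend_backbone_potential[OF ij q]] B.resistance_eq[OF q lB]
  show ?thesis
    using ij bridge in_pverts_compositeI by (auto simp: extend_backbone_eq)
qed

text \<open>
  The current from \<open>u\<close> to \<open>v\<close> passes both bridges.  Superposing the potentials of its three legs
  \<open>u \<rightarrow> l i \<rightarrow> l j \<rightarrow> v\<close> adds their voltage drops, because each of them is constant along the other
  two legs.
\<close>

lemma resistance_different_subgraphs:
  assumes ij: "i \<in> {1..n}" "j \<in> {1..n}" "i \<noteq> j"
    and u: "u \<in> pverts (G i)" and v: "v \<in> pverts (G j)"
  shows "resistance H u v
    = resistance (G i) u (l i) + resistance H (l i) (l j) + resistance (G j) v (l j)"
proof -
  interpret Gi: connected_pair_graph "G i" by (rule subgraph) fact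
  interpret Gj: connected_pair_graph "G j" by (rule subgraph) fact
  have li: "l i \<in> pverts (G i)" and lj: "l j \<in> pverts (G j)"
    using bridge ij by auto
  note lB = bridge_in_backbone[OF ij(1)] bridge_in_backbone[OF ij(2)]
  obtain p q r where p: "unit_current_potential (G i) u (l i) p"
    and q: "unit_current_potential B (l i) (l j) q"
    and r: "unit_current_potential (G j) (l j) v r"
    using Gi.ex_unit_current_potential[OF u li] B.ex_unit_current_potential[OF lB]
      Gj.ex_unit_current_potential[OF lj v] by blast
  let ?P = "\<lambda>x. extend_block i p x + (extend_backbone q x + extend_block j r x)"
  have "unit_current_potential H u v ?P"
    using extend_block_potential[OF ij(1) u li p] extend_backbone_potential[OF ij(1,2) q]
      extend_block_potential[OF ij(2) lj v r]
    by (intro unit_current_potential_series)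
  then have "resistance H u v = ?P u - ?P v"
    using H.resistance_eq in_pverts_compositeI ij u v by blast
  also have "\<dots> = (p u - p (l i)) + (q (l i) - q (l j)) + (r (l j) - r v)"
    using ij u v
    by (simp add: extend_block_other extend_backbone_eq) (simp add: extend_block_def)
  finally show ?thesis
    using Gi.resistance_eq[OF p u li] B.resistance_eq[OF q lB] Gj.resistance_eq[OF r lj v]
      resistance_bridges[OF ij(1,2)] Gj.resistance_commute[OF lj v]
    by simp
qed

lemma sum_pverts_composite:
  "(\<Sum>x\<in>pverts H. f x) = (\<Sum>i = 1..n. \<Sum>x\<in>pverts (G i). f x)"
proof -
  have "finite (pverts (G i))" if "i \<in> {1..n}" for i
  proof -
    interpret connected_pair_graph "G i" by (rule subgraph) fact
    show ?thesis by (rule pair_finite_verts)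
  qed
  moreover have "\<forall>i\<in>{1..n}. \<forall>j\<in>{1..n}. i \<noteq> j \<longrightarrow> pverts (G i) \<inter> pverts (G j) = {}"
    using disjoint by (auto simp: disjoint_family_on_def)
  ultimately show ?thesis
    unfolding composite_graph_def by (simp add: sum.UNION_disjoint)
qed

lemma card_outside_subgraph:
  assumes i: "i \<in> {1..n}"
  shows "real (card (pverts H - pverts (G i))) = (\<Sum>j\<in>{1..n} - {i}. real (card (pverts (G j))))"
proof -
  have sub: "pverts (G i) \<subseteq> pverts H"
    using i in_pverts_compositeI by blast
  have "real (card (pverts H - pverts (G i))) = real (card (pverts H)) - real (card (pverts (G i)))"
    using sub H.pair_finite_verts
    by (simp add: card_Diff_subset finite_subset card_mono of_nat_diff)
  also have "real (card (pverts H)) = (\<Sum>j = 1..n. real (card (pverts (G j))))"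
    using sum_pverts_composite[of "\<lambda>_. 1 :: real"] by simp
  finally show ?thesis
    using i by (simp add: sum.remove)
qed

lemma sum_resistance_different_subgraphs:
  assumes ij: "i \<in> {1..n}" "j \<in> {1..n}" "i \<noteq> j"
  shows "(\<Sum>u\<in>pverts (G i). \<Sum>v\<in>pverts (G j). resistance H u v)
    = real (card (pverts (G j))) * resistance_centrality (G i) (l i)
      + real (card (pverts (G i))) * real (card (pverts (G j))) * resistance H (l i) (l j)
      + real (card (pverts (G i))) * resistance_centrality (G j) (l j)"
proof -
  interpret Gi: connected_pair_graph "G i" by (rule subgraph) fact
  interpret Gj: connected_pair_graph "G j" by (rule subgraph) fact
  have "(\<Sum>u\<in>pverts (G i). \<Sum>v\<in>pverts (G j). resistance H u v)
      = (\<Sum>u\<in>pverts (G i). \<Sum>v\<in>pverts (G j).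
          resistance (G i) u (l i) + resistance H (l i) (l j) + resistance (G j) v (l j))"
    using resistance_different_subgraphs[OF ij] by (intro sum.cong) auto
  then show ?thesis
    using ij bridge
    by (simp add: sum.distrib sum_distrib_left[symmetric] algebra_simps
        Gi.resistance_centrality_eq_sum Gj.resistance_centrality_eq_sum)
qed

lemma sum_resistance_same_subgraph:
  assumes i: "i \<in> {1..n}"
  shows "(\<Sum>u\<in>pverts (G i). \<Sum>v\<in>pverts (G i). resistance H u v)
    = 4 * real (card (pverts (G i))) * coherence (G i)"
proof -
  interpret Gi: connected_pair_graph "G i" by (rule subgraph) fact
  have "(\<Sum>u\<in>pverts (G i). \<Sum>v\<in>pverts (G i). resistance H u v)
      = (\<Sum>u\<in>pverts (G i). \<Sum>v\<in>pverts (G i). resistance (G i) u v)"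
    using resistance_same_subgraph[OF i] by (intro sum.cong) auto
  then show ?thesis
    by (simp add: Gi.sum_resistance_eq_coherence)
qed

end

section \<open>The coherence formula\<close>

lemma sum_symmetric_pairs:
  fixes f :: "nat \<Rightarrow> nat \<Rightarrow> real"
  assumes "\<And>i j. i \<in> {1..n} \<Longrightarrow> j \<in> {1..n} \<Longrightarrow> f i j = f j i"
  shows "(\<Sum>i = 1..n. \<Sum>j\<in>{1..n} - {i}. f i j) = 2 * (\<Sum>i = 1..n. \<Sum>j = i + 1..n. f i j)"
proof -
  have split: "(\<Sum>j\<in>{1..n} - {i}. f i j) = (\<Sum>j = 1..<i. f i j) + (\<Sum>j = i + 1..n. f i j)"
    if "i \<in> {1..n}" for i
  proof -
    have eq: "{1..n} - {i} = {1..<i} \<union> {i + 1..n}"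
      using that by auto
    show ?thesis
      unfolding eq by (rule sum.union_disjoint) auto
  qed
  have "(\<Sum>i = 1..n. \<Sum>j = 1..<i. f i j) = (\<Sum>(i, j)\<in>(SIGMA i:{1..n}. {1..<i}). f i j)"
    by (simp add: sum.Sigma)
  also have "\<dots> = (\<Sum>(i, j)\<in>(SIGMA i:{1..n}. {i + 1..n}). f j i)"
    by (rule sum.reindex_bij_witness[where i = prod.swap and j = prod.swap]) auto
  also have "\<dots> = (\<Sum>(i, j)\<in>(SIGMA i:{1..n}. {i + 1..n}). f i j)"
    using assms by (intro sum.cong) auto
  also have "\<dots> = (\<Sum>i = 1..n. \<Sum>j = i + 1..n. f i j)"
    by (simp add: sum.Sigma)
  finally have lower_eq_upper: "(\<Sum>i = 1..n. \<Sum>j = 1..<i. f i j) = (\<Sum>i = 1..n. \<Sum>j = i + 1..n. f i j)" .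
  have "(\<Sum>i = 1..n. \<Sum>j\<in>{1..n} - {i}. f i j)
      = (\<Sum>i = 1..n. (\<Sum>j = 1..<i. f i j) + (\<Sum>j = i + 1..n. f i j))"
    by (intro sum.cong refl split)
  then show ?thesis
    using lower_eq_upper by (simp add: sum.distrib)
qed

context composite
begin

text \<open>
  The total resistance of \<open>H\<close> is sorted by the pair of subgraphs that contain the two endpoints.
  Diagonal pairs contribute the coherences of the subgraphs, off-diagonal pairs the backbone
  resistances and the centralities.
\<close>

lemma coherence_composite:
  "coherence H = 1 / (2 * real (card (pverts H))) *
     ((\<Sum>i = 1..n. 2 * real (card (pverts (G i))) * coherence (G i))
      + (\<Sum>i = 1..n. \<Sum>j = i + 1..n.
           real (card (pverts (G i))) * real (card (pverts (G j))) * resistance H (l i) (l j))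
      + (\<Sum>i = 1..n. real (card (pverts H - pverts (G i))) * resistance_centrality (G i) (l i)))"
    (is "_ = _ * (?S + ?R + ?C)")
proof -
  define c where "c i = real (card (pverts (G i)))" for i
  define C where "C i = resistance_centrality (G i) (l i)" for i
  define R where "R i j = c i * c j * resistance H (l i) (l j)" for i j
  have "4 * real (card (pverts H)) * coherence H
      = (\<Sum>i = 1..n. \<Sum>u\<in>pverts (G i). \<Sum>j = 1..n. \<Sum>v\<in>pverts (G j). resistance H u v)"
    by (simp add: H.sum_resistance_eq_coherence[symmetric] sum_pverts_composite)
  also have "\<dots> = (\<Sum>i = 1..n. \<Sum>j = 1..n. \<Sum>u\<in>pverts (G i). \<Sum>v\<in>pverts (G j). resistance H u v)"
    by (intro sum.cong refl sum.swap)
  also have "\<dots> = (\<Sum>i = 1..n. 4 * c i * coherence (G i)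
      + (\<Sum>j\<in>{1..n} - {i}. c j * C i + R i j + c i * C j))"
    by (intro sum.cong refl)
      (simp add: sum.remove sum_resistance_same_subgraph sum_resistance_different_subgraphs
        c_def C_def R_def)
  also have "\<dots> = (\<Sum>i = 1..n. 4 * c i * coherence (G i))
      + (\<Sum>i = 1..n. \<Sum>j\<in>{1..n} - {i}. R i j)
      + ((\<Sum>i = 1..n. \<Sum>j\<in>{1..n} - {i}. c j * C i) + (\<Sum>i = 1..n. \<Sum>j\<in>{1..n} - {i}. c i * C j))"
    by (simp add: sum.distrib)
  \<comment> \<open>Each centrality occurs once for either endpoint; exchanging the two indices merges the two sums.\<close>
  also have "(\<Sum>i = 1..n. \<Sum>j\<in>{1..n} - {i}. c i * C j) = (\<Sum>i = 1..n. \<Sum>j\<in>{1..n} - {i}. c j * C i)"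
  proof -
    have "{1..n} - {i} = {j \<in> {1..n}. i \<noteq> j}" "{1..n} - {i} = {j \<in> {1..n}. j \<noteq> i}" for i
      by auto
    then show ?thesis
      using sum.swap_restrict[of "{1..n}" "{1..n}" "\<lambda>i j. c i * C j" "\<lambda>i j. i \<noteq> j"] by simp
  qed
  also have "(\<Sum>i = 1..n. \<Sum>j\<in>{1..n} - {i}. c j * C i) = ?C"
    by (intro sum.cong refl) (simp add: card_outside_subgraph c_def C_def sum_distrib_right)
  also have "(\<Sum>i = 1..n. \<Sum>j\<in>{1..n} - {i}. R i j) = 2 * ?R"
  proof -
    have "R i j = R j i" if "i \<in> {1..n}" "j \<in> {1..n}" for i j
      using that H.resistance_commute[of "l i" "l j"] bridge in_pverts_compositeI by (auto simp: R_def)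
    then show ?thesis
      using sum_symmetric_pairs[of n R] by (simp add: R_def c_def)
  qed
  also have "(\<Sum>i = 1..n. 4 * c i * coherence (G i)) = 2 * ?S"
    by (simp add: c_def sum_distrib_left mult.assoc)
  finally show ?thesis
    using H.card_pverts_pos H.nonempty by (simp add: field_simps)
qed

end

section \<open>Moving the bridges\<close>

definition relabel :: "('a \<Rightarrow> 'b) \<Rightarrow> 'a pair_pre_digraph \<Rightarrow> 'b pair_pre_digraph" where
  "relabel f G = \<lparr>pverts = f ` pverts G, parcs = map_prod f f ` parcs G\<rparr>"

context pair_graph
begin

context
  fixes f :: "'a \<Rightarrow> 'b"
  assumes inj: "inj_on f (pverts G)"
begin

lemma relabel_arc_iff:
  assumes "x \<in> pverts G" "y \<in> pverts G"
  shows "(f x, f y) \<in> parcs (relabel f G) \<longleftrightarrow> (x, y) \<in> parcs G"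
proof
  assume "(f x, f y) \<in> parcs (relabel f G)"
  then obtain x' y' where "(x', y') \<in> parcs G" "f x = f x'" "f y = f y'"
    by (auto simp: relabel_def)
  then show "(x, y) \<in> parcs G"
    using inj assms in_arcsD1 in_arcsD2 by (metis inj_onD)
qed (force simp: relabel_def)

lemma pair_graph_relabel: "pair_graph (relabel f G)"
proof
  fix e assume "e \<in> parcs (relabel f G)"
  then obtain x y where e: "e = (f x, f y)" and xy: "(x, y) \<in> parcs G"
    by (auto simp: relabel_def)
  show "fst e \<in> pverts (relabel f G)" "snd e \<in> pverts (relabel f G)"
    using e in_arcsD1[OF xy] in_arcsD2[OF xy] by (simp_all add: relabel_def)
  show "fst e \<noteq> snd e"
    using e inj_onD[OF inj _ in_arcsD1[OF xy] in_arcsD2[OF xy]] no_loops'[OF xy] by auto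
next
  show "finite (pverts (relabel f G))" "finite (parcs (relabel f G))"
    using pair_finite_verts pair_finite_arcs by (simp_all add: relabel_def)
  show "symmetric (with_proj (relabel f G))"
    using arcs_symmetric by (force simp: symmetric_def sym_def relabel_def)
qed

lemma connected_relabel:
  assumes "Digraph_Component.connected (with_proj G)"
  shows "Digraph_Component.connected (with_proj (relabel f G))"
proof -
  interpret R: pair_graph "relabel f G" by (rule pair_graph_relabel)
  have path: "(f x, f y) \<in> (parcs (relabel f G))\<^sup>*" if "(x, y) \<in> (parcs G)\<^sup>*" for x y
    using that
  proof (induction rule: rtrancl_induct)
    case (step y z)
    from step.hyps(2) have "(f y, f z) \<in> parcs (relabel f G)"
      by (force simp: relabel_def)
    with step.IH show ?case by simp
  qed simp
  then show ?thesis
    using assms connected_iff_rtrancl R.connected_iff_rtrancl by (auto simp: relabel_def)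
qed

lemma net_current_relabel:
  assumes w: "w \<in> pverts G"
  shows "net_current (relabel f G) p (f w) = net_current G (p \<circ> f) w"
proof -
  have "{x. (f w, x) \<in> parcs (relabel f G)} = f ` {x. (w, x) \<in> parcs G}"
  proof (intro equalityI subsetI)
    fix y assume y: "y \<in> {x. (f w, x) \<in> parcs (relabel f G)}"
    then obtain x where "x \<in> pverts G" "y = f x"
      using in_arcsD2 by (auto simp: relabel_def)
    then show "y \<in> f ` {x. (w, x) \<in> parcs G}"
      using relabel_arc_iff w y by auto
  qed (force simp: relabel_def)
  moreover have "inj_on f {x. (w, x) \<in> parcs G}"
    using inj by (rule inj_on_subset) (auto dest: in_arcsD2)
  ultimately show ?thesis
    by (simp add: net_current_def sum.reindex)
qed

text \<open>
  Composition with \<open>f\<close> turns the potentials of the relabelled graph into those of \<open>G\<close> with the same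
  voltage drop.
\<close>

lemma resistance_relabel:
  assumes uv: "u \<in> pverts G" "v \<in> pverts G"
  shows "resistance (relabel f G) (f u) (f v) = resistance G u v"
proof -
  have "pverts (relabel f G) = f ` pverts G"
    by (simp add: relabel_def)
  then have potential: "unit_current_potential (relabel f G) (f u) (f v) p \<longleftrightarrow>
      unit_current_potential G u v (p \<circ> f)" for p
    using uv by (simp add: unit_current_potential_iff net_current_relabel inj_on_eq_iff[OF inj])
  have "\<exists>p. unit_current_potential G u v (p \<circ> f) \<and> p (f u) = q u \<and> p (f v) = q v"
    if q: "unit_current_potential G u v q" for q
  proof -
    \<comment> \<open>The potential \<open>q\<close> carried over to the new labels; off the image of \<open>f\<close> its value is arbitrary.\<close>
    define p where "p = q \<circ> the_inv_into (pverts G) f"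
    have p: "(p \<circ> f) x = q x" if "x \<in> pverts G" for x
      using inj that by (simp add: p_def the_inv_into_f_f)
    then have "unit_current_potential G u v (p \<circ> f)"
      using q net_current_cong[of "p \<circ> f" q] by (simp add: unit_current_potential_iff)
    then show ?thesis
      using p uv by auto
  qed
  then have "(\<exists>p. unit_current_potential (relabel f G) (f u) (f v) p \<and> r = p (f u) - p (f v)) \<longleftrightarrow>
      (\<exists>p. unit_current_potential G u v p \<and> r = p u - p v)" for r
    unfolding potential by (metis comp_apply)
  then show ?thesis
    by (simp add: resistance_def)
qed

end

end

context composite
begin

context
  fixes l' :: "nat \<Rightarrow> 'a"
  assumes bridge': "\<And>i. i \<in> {1..n} \<Longrightarrow> l' i \<in> pverts (G i)"
begin

abbreviation "B' \<equiv> backbone_of n (backbone_topology n l B) l'"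

text \<open>
  The backbone rebuilt on the bridges \<open>l'\<close> from the topology of \<open>B\<close> is an isomorphic copy of \<open>B\<close>; this
  makes it a connected graph and determines its resistances.
\<close>

lemma ex_backbone_relabelling:
  "\<exists>f. inj_on f (pverts B) \<and> relabel f B = B' \<and> (\<forall>i\<in>{1..n}. f (l i) = l' i)"
proof -
  have inj: "inj_on l {1..n}"
    using bridge_inj by (auto simp: inj_on_def)
  define f where "f = l' \<circ> the_inv_into {1..n} l"
  have f: "f (l i) = l' i" if "i \<in> {1..n}" for i
    using that inj by (simp add: f_def the_inv_into_f_f)
  have "inj_on f (pverts B)"
  proof (rule inj_onI)
    fix x y assume xy: "x \<in> pverts B" "y \<in> pverts B" "f x = f y"
    then obtain i j where "i \<in> {1..n}" "x = l i" "j \<in> {1..n}" "y = l j"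
      unfolding pverts_backbone by blast
    with xy(3) f bridge' same_subgraph show "x = y" by metis
  qed
  moreover have "relabel f B = B'"
  proof -
    have "f ` pverts B = l' ` {1..n}"
      unfolding pverts_backbone using f by force
    moreover have "map_prod f f ` parcs B = (\<lambda>(i, j). (l' i, l' j)) ` backbone_topology n l B"
    proof (intro equalityI subsetI)
      fix e assume "e \<in> map_prod f f ` parcs B"
      then obtain x y where e: "(x, y) \<in> parcs B" "e = (f x, f y)"
        by auto
      then obtain i j where "i \<in> {1..n}" "x = l i" "j \<in> {1..n}" "y = l j"
        using B.in_arcsD1 B.in_arcsD2 unfolding pverts_backbone by blast
      then have "(i, j) \<in> backbone_topology n l B" "e = (l' i, l' j)"
        using e f by (auto simp: backbone_topology_def)
      then show "e \<in> (\<lambda>(i, j). (l' i, l' j)) ` backbone_topology n l B"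
        by force
    next
      fix e assume "e \<in> (\<lambda>(i, j). (l' i, l' j)) ` backbone_topology n l B"
      then obtain i j where "(l i, l j) \<in> parcs B" "e = (f (l i), f (l j))"
        using f by (auto simp: backbone_topology_def)
      then show "e \<in> map_prod f f ` parcs B"
        by (metis map_prod_imageI)
    qed
    ultimately show ?thesis
      by (simp add: relabel_def backbone_of_def)
  qed
  ultimately show ?thesis
    using f by blast
qed

lemma composite_moved_bridges: "composite n G l' B'"
proof (rule composite.intro)
  obtain f where f: "inj_on f (pverts B)" "relabel f B = B'" "\<forall>i\<in>{1..n}. f (l i) = l' i"
    using ex_backbone_relabelling by blast
  show "connected_pair_graph B'"
    using B.pair_graph_relabel[OF f(1)] B.connected_relabel[OF f(1) B.connected] f(2)
    by (simp add: connected_pair_graph_def connected_pair_graph_axioms_def)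
  show "pverts B' = l' ` {1..n}"
    by (simp add: backbone_of_def)
qed (fact subgraph disjoint bridge')+

lemma resistance_moved_bridges:
  assumes ij: "i \<in> {1..n}" "j \<in> {1..n}"
  shows "resistance (composite_graph n G B') (l' i) (l' j) = resistance B (l i) (l j)"
proof -
  interpret C: composite n G l' B' by (rule composite_moved_bridges)
  obtain f where f: "inj_on f (pverts B)" "relabel f B = B'" "\<forall>i\<in>{1..n}. f (l i) = l' i"
    using ex_backbone_relabelling by blast
  have "resistance B' (l' i) (l' j) = resistance B (l i) (l j)"
    using B.resistance_relabel[OF f(1) bridge_in_backbone[OF ij(1)] bridge_in_backbone[OF ij(2)]] f ij
    by simp
  then show ?thesis
    using C.resistance_bridges[OF ij] by simp
qed

end

text \<open>
  In the coherence formulas for \<open>m\<close> and \<open>l'\<close>, the subgraph terms agree trivially and the bridge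
  resistances agree because both equal those of \<open>B\<close>; only the centralities differ.
\<close>

lemma coherence_mono_bridges:
  assumes m: "\<And>i. i \<in> {1..n} \<Longrightarrow> m i \<in> pverts (G i)"
    and l': "\<And>i. i \<in> {1..n} \<Longrightarrow> l' i \<in> pverts (G i)"
    and le: "\<And>i. i \<in> {1..n} \<Longrightarrow> resistance_centrality (G i) (m i) \<le> resistance_centrality (G i) (l' i)"
  shows "coherence (composite_graph n G (B' m)) \<le> coherence (composite_graph n G (B' l'))"
proof -
  interpret M: composite n G m "B' m"
    using m by (rule composite_moved_bridges)
  interpret L: composite n G l' "B' l'"
    using l' by (rule composite_moved_bridges)
  have verts: "pverts M.H = pverts L.H"
    by (simp add: composite_graph_def)
  have res: "(\<Sum>i = 1..n. \<Sum>j = i + 1..n. c i j * resistance M.H (m i) (m j))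
      = (\<Sum>i = 1..n. \<Sum>j = i + 1..n. c i j * resistance L.H (l' i) (l' j))" for c
    using resistance_moved_bridges[OF m] resistance_moved_bridges[OF l'] by (intro sum.cong refl) auto
  show ?thesis
    unfolding M.coherence_composite L.coherence_composite verts res
    using le by (intro mult_left_mono add_left_mono sum_mono) auto
qed

end

theorem theorem1:
  fixes n :: nat
    and G :: "nat \<Rightarrow> 'a pair_pre_digraph"
    and l :: "nat \<Rightarrow> 'a"
    and B :: "'a pair_pre_digraph"
  assumes graph: "\<And>i. i \<in> {1..n} \<Longrightarrow> pair_graph (G i)"
    and connected: "\<And>i. i \<in> {1..n} \<Longrightarrow> Digraph_Component.connected (with_proj (G i))"
    and disjoint: "disjoint_family_on (\<lambda>i. pverts (G i)) {1..n}"
    and bridge: "\<And>i. i \<in> {1..n} \<Longrightarrow> l i \<in> pverts (G i)"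
    and backbone_graph: "pair_graph B"
    and backbone_verts: "pverts B = l ` {1..n}"
    and backbone_connected: "Digraph_Component.connected (with_proj B)"
  shows
    "(let H = composite_graph n G B; N = card (pverts H) in
      coherence H =
        1 / (2 * real N) *
          ((\<Sum>i = 1..n. 2 * real (card (pverts (G i))) * coherence (G i))
           + (\<Sum>i = 1..n. \<Sum>j = i + 1..n.
                real (card (pverts (G i))) * real (card (pverts (G j))) * resistance H (l i) (l j))
           + (\<Sum>i = 1..n.
                real (card (pverts H - pverts (G i))) * resistance_centrality (G i) (l i))))
     \<and>
     (\<forall>m. (\<forall>i\<in>{1..n}. is_arg_min (resistance_centrality (G i)) (\<lambda>v. v \<in> pverts (G i)) (m i)) \<longrightarrow>
        is_arg_min
          (\<lambda>l'. coherence (composite_graph n G (backbone_of n (backbone_topology n l B) l')))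
          (\<lambda>l'. \<forall>i\<in>{1..n}. l' i \<in> pverts (G i)) m)"
proof -
  interpret composite n G l B
    by (rule composite.intro)
      (use assms in \<open>simp_all add: connected_pair_graph_def connected_pair_graph_axioms_def\<close>)
  have "is_arg_min
      (\<lambda>l'. coherence (composite_graph n G (backbone_of n (backbone_topology n l B) l')))
      (\<lambda>l'. \<forall>i\<in>{1..n}. l' i \<in> pverts (G i)) m"
    if "\<forall>i\<in>{1..n}. is_arg_min (resistance_centrality (G i)) (\<lambda>v. v \<in> pverts (G i)) (m i)" for m
    using that coherence_mono_bridges[of m] unfolding is_arg_min_linorder by blast
  then show ?thesis
    unfolding Let_def using coherence_composite by blast
qed

end
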